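(* (d'Ocagne's identity.) For all integers $n,m\ge 0$, the bicomplex Pell numbers satisfy $$BP_m\,BP_{n+1}-BP_{m+1}\,BP_n=12\,(-1)^n\,P_{m-n}\,(j+ij).$$
   Context: The bicomplex numbers $\mathbb{C}_2=\{q_1+iq_2+jq_3+ijq_4 : q_1,q_2,q_3,q_4\in\mathbb{R}\}$ form the commutative associative real algebra with basis $1,i,j,ij$ and multiplication determined by $i^2=-1$, $j^2=-1$, $ij=ji$ (so $(ij)^2=1$). The Pell numbers are given by $P_0=0$, $P_1=1$, $P_n=2P_{n-1}+P_{n-2}$, extended to all integer indices by the recurrence (so $P_{-n}=(-1)^{n+1}P_n$). The bicomplex Pell numbers are $BP_n=P_n+iP_{n+1}+jP_{n+2}+ijP_{n+3}$. *)

theory Defs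
  imports Complex_Main
begin

section \<open>The bicomplex numbers\<close>

text \<open>\<open>Bicomplex a b c d\<close> stands for \<open>a + i b + j c + ij d\<close>.\<close>

datatype bicomplex = Bicomplex (bc1: real) (bci: real) (bcj: real) (bcij: real)

lemma bicomplex_eq_iff:
  "x = y \<longleftrightarrow> bc1 x = bc1 y \<and> bci x = bci y \<and> bcj x = bcj y \<and> bcij x = bcij y"
  by (cases x; cases y) simp

text \<open>The product is the bilinear extension of \<open>i\<^sup>2 = j\<^sup>2 = -1\<close>, \<open>i j = j i\<close>;
  in particular \<open>(ij)\<^sup>2 = 1\<close>.\<close>

instantiation bicomplex :: "{comm_ring_1, real_algebra_1}"
begin

definition "0 = Bicomplex 0 0 0 0"
definition "1 = Bicomplex 1 0 0 0"
definition "x + y = Bicomplex (bc1 x + bc1 y) (bci x + bci y) (bcj x + bcj y) (bcij x + bcij y)"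
definition "- x = Bicomplex (- bc1 x) (- bci x) (- bcj x) (- bcij x)"
definition "x - y = Bicomplex (bc1 x - bc1 y) (bci x - bci y) (bcj x - bcj y) (bcij x - bcij y)"
definition "r *\<^sub>R x = Bicomplex (r * bc1 x) (r * bci x) (r * bcj x) (r * bcij x)"
definition "x * y = Bicomplex
  (bc1 x * bc1 y - bci x * bci y - bcj x * bcj y + bcij x * bcij y)
  (bc1 x * bci y + bci x * bc1 y - bcj x * bcij y - bcij x * bcj y)
  (bc1 x * bcj y + bcj x * bc1 y - bci x * bcij y - bcij x * bci y)
  (bc1 x * bcij y + bcij x * bc1 y + bci x * bcj y + bcj x * bci y)"

instance
  by standard
    (simp_all add: bicomplex_eq_iff zero_bicomplex_def one_bicomplex_def plus_bicomplex_def
      uminus_bicomplex_def minus_bicomplex_def scaleR_bicomplex_def times_bicomplex_def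
      algebra_simps)

end

definition bi :: bicomplex where "bi = Bicomplex 0 1 0 0"
definition bj :: bicomplex where "bj = Bicomplex 0 0 1 0"

lemma bi_squared: "bi * bi = - 1"
  and bj_squared: "bj * bj = - 1"
  and bi_bj: "bi * bj = Bicomplex 0 0 0 1"
  by (simp_all add: bi_def bj_def times_bicomplex_def uminus_bicomplex_def one_bicomplex_def)

lemma Bicomplex_eq_basis:
  "Bicomplex a b c d = a *\<^sub>R 1 + b *\<^sub>R bi + c *\<^sub>R bj + d *\<^sub>R (bi * bj)"
  by (simp add: bi_bj) (simp add: bi_def bj_def one_bicomplex_def plus_bicomplex_def
    scaleR_bicomplex_def)

section \<open>Pell numbers and bicomplex Pell numbers\<close>

text \<open>For negative indices the recurrence is run backwards.\<close>

function pell :: "int \<Rightarrow> int" where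
  "pell n = (if n = 0 then 0 else if n = 1 then 1
     else if n > 1 then 2 * pell (n - 1) + pell (n - 2)
     else pell (n + 2) - 2 * pell (n + 1))"
  by auto
termination
  by (relation "measure (\<lambda>n. nat \<bar>2 * n - 1\<bar>)") auto

declare pell.simps [simp del]

lemma pell_0: "pell 0 = 0"
  and pell_1: "pell 1 = 1"
  by (simp_all add: pell.simps)

lemma pell_rec: "pell n = 2 * pell (n - 1) + pell (n - 2)"
proof (cases "n > 1")
  case True
  then show ?thesis by (subst pell.simps) simp
next
  case False
  then have "pell (n - 2) = pell n - 2 * pell (n - 1)"
    by (subst pell.simps) simp
  then show ?thesis by simp
qed

lemma pell_minus: "pell (- int n) = (- 1) ^ (n + 1) * pell (int n)"
proof (induction n rule: less_induct)
  case (less n)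
  consider "n = 0" | "n = 1" | k where "n = Suc (Suc k)"
    by (metis One_nat_def not0_implies_Suc)
  then show ?case
  proof cases
    case 1
    then show ?thesis by (simp add: pell_0)
  next
    case 2
    then show ?thesis using pell_rec[of 1] by (simp add: pell_0 pell_1)
  next
    case (3 k)
    have "pell (- int n) = pell (- int k) - 2 * pell (- int (Suc k))"
      using pell_rec[of "- int k"] 3 by (simp add: minus_diff_commute)
    also have "\<dots> = (- 1) ^ (k + 1) * (pell (int k) + 2 * pell (int (Suc k)))"
      using less[of k] less[of "Suc k"] 3 by (simp add: algebra_simps)
    also have "\<dots> = (- 1) ^ (n + 1) * pell (int n)"
      using pell_rec[of "int n"] 3 by (simp add: algebra_simps)
    finally show ?thesis .
  qed
qed

definition bicomplex_pell :: "int \<Rightarrow> bicomplex" where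
  "bicomplex_pell n = of_int (pell n) + bi * of_int (pell (n + 1))
     + bj * of_int (pell (n + 2)) + bi * bj * of_int (pell (n + 3))"

end

theory Submission
  imports Defs
begin

text \<open>
  The identity holds because d'Ocagne's identity only uses the recurrence. Let \<open>u\<close> be any
  two-sided sequence in a commutative ring with \<open>u (k + 2) = 2 u (k + 1) + u k\<close>, and let
  \<open>D m n = u m * u (n + 1) - u (m + 1) * u n\<close>. This is the determinant of a \<open>2 \<times> 2\<close> matrix whose
  rows are consecutive terms of \<open>u\<close>; moving both rows one step along multiplies it by the
  determinant \<open>-1\<close> of the companion matrix of the recurrence. Hence \<open>D m n = (-1)\<^sup>n D (m - n) 0\<close>.
  As a function of its first argument, \<open>D _ 0\<close> satisfies the recurrence itself and vanishes at
  \<open>0\<close>, so it is a multiple of the Pell sequence (lemma \<open>pell_recurrence_multiple\<close>), with factor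
  \<open>D 1 0 = (u 1)\<^sup>2 - u 2 * u 0\<close>. That is lemma \<open>dOcagne_pell_recurrence\<close>.

  The bicomplex Pell numbers satisfy the recurrence because their four components do, and the
  factor \<open>(BP 1)\<^sup>2 - BP 2 * BP 0\<close> evaluates to \<open>12 (j + ij)\<close>.
\<close>

text \<open>The recurrence can be run in both directions, so two consecutive values determine the
  sequence at all integers; the induction carries such a pair.\<close>

lemma pell_recurrence_multiple:
  fixes v :: "int \<Rightarrow> 'a::comm_ring_1"
  assumes rec: "\<And>k. v (k + 2) = 2 * v (k + 1) + v k" and v0: "v 0 = 0"
  shows "v k = of_int (pell k) * v 1"
proof -
  have "v k = of_int (pell k) * v 1 \<and> v (k + 1) = of_int (pell (k + 1)) * v 1"
  proof (induction k rule: int_induct[where k = 0])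
    case base
    show ?case by (simp add: v0 pell_0 pell_1)
  next
    case (step1 i)
    have "pell (i + 2) = 2 * pell (i + 1) + pell i"
      using pell_rec[of "i + 2"] by (simp add: algebra_simps)
    with step1 rec[of i] show ?case by (simp add: algebra_simps)
  next
    case (step2 i)
    have "pell (i - 1) = pell (i + 1) - 2 * pell i"
      using pell_rec[of "i + 1"] by simp
    moreover have "v (i - 1) = v (i + 1) - 2 * v i"
      using rec[of "i - 1"] by (simp add: algebra_simps)
    ultimately show ?case using step2 by (simp add: left_diff_distrib mult.assoc)
  qed
  then show ?thesis ..
qed

lemma dOcagne_pell_recurrence:
  fixes u :: "int \<Rightarrow> 'a::comm_ring_1"
  assumes rec: "\<And>k. u (k + 2) = 2 * u (k + 1) + u k"
  shows "u m * u (int n + 1) - u (m + 1) * u (int n)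
    = (- 1) ^ n * of_int (pell (m - int n)) * (u 1 * u 1 - u 2 * u 0)"
proof (induction n arbitrary: m)
  case 0
  define v where "v k = u k * u 1 - u (k + 1) * u 0" for k
  have "v (k + 2) = 2 * v (k + 1) + v k" for k
    using rec[of k] rec[of "k + 1"] by (simp add: v_def algebra_simps)
  moreover have "v 0 = 0"
    by (simp add: v_def)
  ultimately have "v m = of_int (pell m) * v 1"
    by (rule pell_recurrence_multiple)
  then show ?case by (simp add: v_def)
next
  case (Suc n)
  have "u m * u (int (Suc n) + 1) - u (m + 1) * u (int (Suc n))
      = - (u (m - 1) * u (int n + 1) - u (m - 1 + 1) * u (int n))"
    using rec[of "int n"] rec[of "m - 1"] by (simp add: algebra_simps)
  also have "\<dots> = - ((- 1) ^ n * of_int (pell (m - 1 - int n)) * (u 1 * u 1 - u 2 * u 0))"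
    by (simp only: Suc.IH)
  also have "m - 1 - int n = m - int (Suc n)"
    by simp
  finally show ?case by simp
qed

lemma bicomplex_pell_rec:
  "bicomplex_pell (k + 2) = 2 * bicomplex_pell (k + 1) + bicomplex_pell k"
proof -
  have pell: "pell (l + 2) = 2 * pell (l + 1) + pell l" for l
    using pell_rec[of "l + 2"] by (simp add: algebra_simps)
  show ?thesis
    using pell[of k] pell[of "k + 1"] pell[of "k + 2"] pell[of "k + 3"]
    by (simp add: bicomplex_pell_def algebra_simps)
qed

lemma bicomplex_pell_Cassini_initial:
  "bicomplex_pell 1 * bicomplex_pell 1 - bicomplex_pell 2 * bicomplex_pell 0
    = 12 * (bj + bi * bj)"
proof -
  have pell: "pell 2 = 2" "pell 3 = 5" "pell 4 = 12" "pell 5 = 29"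
    using pell_rec[of 2] pell_rec[of 3] pell_rec[of 4] pell_rec[of 5]
    by (simp_all add: pell_0 pell_1)
  have of_int: "of_int a = Bicomplex (of_int a) 0 0 0" for a
  proof -
    have "of_int a = (of_int a :: real) *\<^sub>R (1 :: bicomplex)"
      by (simp add: scaleR_conv_of_real)
    then show ?thesis by (simp add: one_bicomplex_def scaleR_bicomplex_def)
  qed
  have components:
    "bicomplex_pell n = Bicomplex (pell n) (pell (n + 1)) (pell (n + 2)) (pell (n + 3))" for n
    by (simp add: bicomplex_pell_def of_int bi_def bj_def times_bicomplex_def plus_bicomplex_def)
  have twelve: "(12 :: bicomplex) = Bicomplex 12 0 0 0"
    using of_int[of 12] by simp
  show ?thesis
    by (simp add: components twelve pell pell_0 pell_1 bi_def bj_def times_bicomplex_def plus_bicomplex_def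
        minus_bicomplex_def)
qed

theorem theorem2p4:
  fixes m n :: int
  assumes "m \<ge> 0" and "n \<ge> 0"
  shows "bicomplex_pell m * bicomplex_pell (n + 1) - bicomplex_pell (m + 1) * bicomplex_pell n
    = 12 * (- 1) ^ nat n * of_int (pell (m - n)) * (bj + bi * bj)"
proof -
  have "bicomplex_pell m * bicomplex_pell (n + 1) - bicomplex_pell (m + 1) * bicomplex_pell n
      = (- 1) ^ nat n * of_int (pell (m - n)) * (12 * (bj + bi * bj))"
    using dOcagne_pell_recurrence[of bicomplex_pell m "nat n", OF bicomplex_pell_rec] assms(2)
    by (simp only: bicomplex_pell_Cassini_initial int_nat_eq if_True)
  then show ?thesis by (simp only: mult_ac)
qed

end
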